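(* Let $\alpha\in(0,1)$, $\sigma=1-\alpha/2\in(1/2,1)$, $T>0$, $\tau=T/M$ with $M$ a positive integer, and let $\lambda\in\mathcal{C}^2[0,T]$ satisfy $\lambda(t)>0$ and $\lambda'(t)\le0$ for all $t\in[0,T]$. Let $1\le j\le M-1$ and let $c_s^{(\alpha)}$, $0\le s\le j$, be the coefficients defined (for this $j$) in the context. Then $$c_j^{(\alpha)}>\frac{1-\alpha}{2}\,\frac{\lambda_{j+\sigma}}{(j+\sigma)^\alpha},$$ $$(2\sigma-1)c_0^{(\alpha)}-\sigma c_1^{(\alpha)}>0,$$ $$c_0^{(\alpha)}>c_1^{(\alpha)}>c_2^{(\alpha)}>\dots>c_{j-1}^{(\alpha)}>c_j^{(\alpha)}.$$
   Context: Write $\lambda_s=\lambda(s\tau)$ for real $s$, $$a_0^{(\alpha)}=\sigma^{1-\alpha},\qquad a_l^{(\alpha)}=(l+\sigma)^{1-\alpha}-(l-1+\sigma)^{1-\alpha}\quad(l\ge1),$$ $$b_l^{(\alpha)}=\tfrac{1}{2-\alpha}\left[(l+\sigma)^{2-\alpha}-(l-1+\sigma)^{2-\alpha}\right]-\tfrac12\left[(l+\sigma)^{1-\alpha}+(l-1+\sigma)^{1-\alpha}\right]\quad(l\ge1).$$ For $j\ge1$ the coefficients (which depend on $j$) are $$c_s^{(\alpha)}=\begin{cases}\lambda_{\sigma-1/2}a_0^{(\alpha)}+\lambda_\sigma b_1^{(\alpha)}, & s=0,\\ \lambda_{s+\sigma-1/2}a_s^{(\alpha)}+\lambda_{s+\sigma}b_{s+1}^{(\alpha)}-\lambda_{s+\sigma}b_s^{(\alpha)},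 & 1\le s\le j-1,\\ \lambda_{j+\sigma-1/2}a_j^{(\alpha)}-\lambda_{j+\sigma}b_j^{(\alpha)}, & s=j.\end{cases}$$ *)

theory Defs
  imports Complex_Main
begin

definition a_coeff :: "real \<Rightarrow> real \<Rightarrow> nat \<Rightarrow> real" where
  "a_coeff \<alpha> \<sigma> l =
     (if l = 0 then \<sigma> powr (1 - \<alpha>)
      else (real l + \<sigma>) powr (1 - \<alpha>) - (real l - 1 + \<sigma>) powr (1 - \<alpha>))"

text \<open>Only meaningful for \<open>l \<ge> 1\<close>; the value at \<open>l = 0\<close> is never used.\<close>

definition b_coeff :: "real \<Rightarrow> real \<Rightarrow> nat \<Rightarrow> real" where
  "b_coeff \<alpha> \<sigma> l =
     1 / (2 - \<alpha>) * ((real l + \<sigma>) powr (2 - \<alpha>) - (real l - 1 + \<sigma>) powr (2 - \<alpha>))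
     - 1 / 2 * ((real l + \<sigma>) powr (1 - \<alpha>) + (real l - 1 + \<sigma>) powr (1 - \<alpha>))"

text \<open>\<open>c_coeff \<alpha> \<sigma> \<tau> lam j s\<close> is the coefficient with index \<open>s\<close> belonging to \<open>j \<ge> 1\<close>; it is
  only meaningful for \<open>s \<le> j\<close>, so the last branch is the case \<open>s = j\<close>.
  Here \<open>lam (x * \<tau>)\<close> is what is written \<open>\<lambda>\<close> with subscript \<open>x\<close> on paper.\<close>

definition c_coeff :: "real \<Rightarrow> real \<Rightarrow> real \<Rightarrow> (real \<Rightarrow> real) \<Rightarrow> nat \<Rightarrow> nat \<Rightarrow> real" where
  "c_coeff \<alpha> \<sigma> \<tau> lam j s =
     (if s = 0 then
        lam ((\<sigma> - 1 / 2) * \<tau>) * a_coeff \<alpha> \<sigma> 0 + lam (\<sigma> * \<tau>) * b_coeff \<alpha> \<sigma> 1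
      else if s < j then
        lam ((real s + \<sigma> - 1 / 2) * \<tau>) * a_coeff \<alpha> \<sigma> s
        + lam ((real s + \<sigma>) * \<tau>) * b_coeff \<alpha> \<sigma> (s + 1)
        - lam ((real s + \<sigma>) * \<tau>) * b_coeff \<alpha> \<sigma> s
      else
        lam ((real j + \<sigma> - 1 / 2) * \<tau>) * a_coeff \<alpha> \<sigma> j
        - lam ((real j + \<sigma>) * \<tau>) * b_coeff \<alpha> \<sigma> j)"

end

theory Submission
  imports Defs "HOL-Analysis.Convex"
begin

text \<open>With \<open>p = 1 - \<alpha>\<close>, the number \<open>b\<^sub>l\<close> is the error of the trapezoidal rule for \<open>x\<^sup>p\<close> on an
  interval of length \<open>1\<close>; by the Hermite--Hadamard inequality it is nonnegative (\<open>x\<^sup>p\<close> is concave)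
  and decreasing in \<open>l\<close> (the derivative of \<open>x\<^sup>p\<close> is convex). The difference \<open>a\<^sub>l - b\<^sub>l\<close> is strictly
  decreasing and exceeds \<open>p / 2 \<cdot> (l + \<sigma>)\<^sup>p\<^sup>-\<^sup>1\<close> by the mean value theorem. Every claim
  compares linear combinations of values of \<open>\<lambda>\<close> at increasing arguments; as \<open>\<lambda>\<close> is positive
  and nonincreasing, summation by parts reduces it to the sign of the partial sums of the
  coefficients. The only delicate partial sum is \<open>(2\<sigma> - 1)(a\<^sub>0 + b\<^sub>1) - \<sigma> a\<^sub>1\<close>, which becomes
  the polynomial inequality \<open>(\<sigma> - 1)(2\<sigma> - 1)\<^sup>2 < 0\<close> after an application of Bernoulli's inequality.\<close>

section \<open>Powers of a real variable and the Hermite--Hadamard inequality\<close>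

lemma powr_diff_bounds:
  fixes p x y :: real
  assumes p: "0 < p" "p < 1" and xy: "0 < x" "x < y"
  shows "p * y powr (p - 1) * (y - x) < y powr p - x powr p"
    and "y powr p - x powr p < p * x powr (p - 1) * (y - x)"
proof -
  have "\<exists>z. x < z \<and> z < y \<and> y powr p - x powr p = (y - x) * (p * z powr (p - 1))"
    using xy by (intro MVT2) (auto intro!: derivative_eq_intros)
  then obtain z where z: "x < z" "z < y"
    and eq: "y powr p - x powr p = (y - x) * (p * z powr (p - 1))" by blast
  have "y powr (p - 1) < z powr (p - 1)" "z powr (p - 1) < x powr (p - 1)"
    using z xy p by (auto intro!: powr_less_mono2_neg)
  then show "p * y powr (p - 1) * (y - x) < y powr p - x powr p"
    and "y powr p - x powr p < p * x powr (p - 1) * (y - x)"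
    using eq p xy by (auto simp: mult.commute)
qed

text \<open>The assumption is the sign of the second derivative. The factor \<open>c\<close> lets
  one lemma serve both the negated concave power and the derivative
  \<open>p * x powr (p - 1)\<close>.\<close>

lemma convex_on_powr_scaled:
  fixes c p :: real
  assumes "0 \<le> c * p * (p - 1)"
  shows "convex_on {0<..} (\<lambda>x. c * x powr p)"
proof (rule f''_ge0_imp_convex)
  show "((\<lambda>x. c * x powr p) has_real_derivative c * (p * x powr (p - 1))) (at x)"
    if "x \<in> {0<..}" for x
    using that by (auto intro!: derivative_eq_intros)
  show "((\<lambda>x. c * (p * x powr (p - 1))) has_real_derivative
      c * (p * ((p - 1) * x powr (p - 1 - 1)))) (at x)" if "x \<in> {0<..}" for x
    using that by (auto intro!: derivative_eq_intros)
  show "0 \<le> c * (p * ((p - 1) * x powr (p - 1 - 1)))" for x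
    using mult_nonneg_nonneg[OF assms, of "x powr (p - 1 - 1)"] by (simp add: mult.assoc)
qed auto

text \<open>A convex function lies below its chord, and the chord integrates to the right-hand side.
  An antiderivative \<open>G\<close> stands in for the integral.\<close>

lemma Hermite_Hadamard_upper:
  fixes G g :: "real \<Rightarrow> real"
  assumes "a < b" and conv: "convex_on {a..b} g"
    and der: "\<And>x. x \<in> {a..b} \<Longrightarrow> (G has_real_derivative g x) (at x)"
  shows "G b - G a \<le> (b - a) * (g a + g b) / 2"
proof -
  define m where "m = (g b - g a) / (b - a)"
  \<comment> \<open>\<open>G\<close> minus an antiderivative of the chord of \<open>g\<close>, hence
    nonincreasing.\<close>
  define H where "H = (\<lambda>x. G x - g a * (x - a) - m * (x - a)\<^sup>2 / 2)"
  have "H b \<le> H a"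
  proof (rule DERIV_nonpos_imp_nonincreasing[where f = H])
    fix x assume x: "a \<le> x" "x \<le> b"
    have "(H has_real_derivative g x - g a - m * (x - a)) (at x)"
      unfolding H_def using x by (auto intro!: derivative_eq_intros der)
    moreover have "g x \<le> m * (x - a) + g a"
      unfolding m_def using convex_onD_Icc'[OF conv] x by simp
    ultimately show "\<exists>y. (H has_real_derivative y) (at x) \<and> y \<le> 0"
      by (intro exI[of _ "g x - g a - m * (x - a)"]) auto
  qed (use \<open>a < b\<close> in simp)
  moreover have "m * (b - a)\<^sup>2 = (g b - g a) * (b - a)"
    using \<open>a < b\<close> by (simp add: m_def power2_eq_square)
  ultimately show ?thesis
    by (simp add: H_def) (simp add: field_simps)
qed

section \<open>The trapezoidal error of a power\<close>

text \<open>A real left endpoint \<open>x\<close> instead of the index makes monotonicity accessible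
  to differentiation.\<close>

definition trapezoid_gap :: "real \<Rightarrow> real \<Rightarrow> real" where
  "trapezoid_gap p x =
     ((x + 1) powr (p + 1) - x powr (p + 1)) / (p + 1) - ((x + 1) powr p + x powr p) / 2"

lemma trapezoid_gap_nonneg:
  assumes "0 < p" "p < 1" "0 < x"
  shows "0 \<le> trapezoid_gap p x"
proof -
  have "convex_on {0<..} (\<lambda>y. -1 * y powr p)"
    using assms by (intro convex_on_powr_scaled) (simp add: mult_le_0_iff)
  then have "convex_on {x..x + 1} (\<lambda>y. -1 * y powr p)"
    by (rule convex_on_subset) (use assms in auto)
  moreover have "((\<lambda>y. - (y powr (p + 1) / (p + 1))) has_real_derivative -1 * y powr p) (at y)"
    if "y \<in> {x..x + 1}" for y
    using that assms by (auto intro!: derivative_eq_intros)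
  ultimately show ?thesis
    using Hermite_Hadamard_upper[of x "x + 1" "\<lambda>y. -1 * y powr p" "\<lambda>y. - (y powr (p + 1) / (p + 1))"]
    by (simp add: trapezoid_gap_def diff_divide_distrib add_divide_distrib)
qed

lemma trapezoid_gap_deriv:
  assumes "0 < p" "0 < x"
  shows "(trapezoid_gap p has_real_derivative
    (x + 1) powr p - x powr p - (p * (x + 1) powr (p - 1) + p * x powr (p - 1)) / 2) (at x)"
  unfolding trapezoid_gap_def[abs_def] using assms
  by (auto intro!: derivative_eq_intros simp: diff_divide_distrib)

text \<open>The derivative of the gap is the trapezoidal error of the convex function
  \<open>p * y powr (p - 1)\<close>, hence nonpositive.\<close>

lemma trapezoid_gap_antimono:
  assumes "0 < p" "p < 1" "0 < x" "x \<le> y"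
  shows "trapezoid_gap p y \<le> trapezoid_gap p x"
proof (rule DERIV_nonpos_imp_nonincreasing[OF \<open>x \<le> y\<close>])
  fix z assume "x \<le> z" "z \<le> y"
  then have z: "0 < z" using assms by simp
  have "convex_on {0<..} (\<lambda>y. p * y powr (p - 1))"
    using assms by (intro convex_on_powr_scaled) (simp add: mult_nonneg_nonpos mult_nonpos_nonpos)
  then have "convex_on {z..z + 1} (\<lambda>y. p * y powr (p - 1))"
    by (rule convex_on_subset) (use z in auto)
  moreover have "((\<lambda>y. y powr p) has_real_derivative p * y powr (p - 1)) (at y)"
    if "y \<in> {z..z + 1}" for y
    using that z by (auto intro!: derivative_eq_intros)
  ultimately have "(z + 1) powr p - z powr p \<le> (p * z powr (p - 1) + p * (z + 1) powr (p - 1)) / 2"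
    using Hermite_Hadamard_upper[of z "z + 1" "\<lambda>y. p * y powr (p - 1)" "\<lambda>y. y powr p"] by simp
  then show "\<exists>d. (trapezoid_gap p has_real_derivative d) (at z) \<and> d \<le> 0"
    using trapezoid_gap_deriv[OF \<open>0 < p\<close> z] by (auto intro!: exI)
qed

text \<open>The mean of the increasing power over the interval is at most its value at the right
  endpoint; subtracting the average of the endpoint values leaves half the increment.\<close>

lemma trapezoid_gap_le_half_increment:
  assumes "0 < p" "p < 1" "0 < x"
  shows "trapezoid_gap p x \<le> ((x + 1) powr p - x powr p) / 2"
proof -
  have "\<exists>z. x < z \<and> z < x + 1 \<and>
      (x + 1) powr (p + 1) / (p + 1) - x powr (p + 1) / (p + 1) = (x + 1 - x) * z powr p"
    using assms by (intro MVT2) (auto intro!: derivative_eq_intros)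
  then obtain z where "x < z" "z < x + 1"
    "((x + 1) powr (p + 1) - x powr (p + 1)) / (p + 1) = z powr p"
    by (auto simp: diff_divide_distrib)
  moreover from this have "z powr p \<le> (x + 1) powr p"
    using assms by (intro powr_mono2) auto
  ultimately show ?thesis
    by (simp add: trapezoid_gap_def field_simps)
qed

lemma increment_minus_gap_strict_antimono:
  assumes p: "0 < p" "p < 1" and "0 < x" "x < y"
  shows "(y + 1) powr p - y powr p - trapezoid_gap p y
    < (x + 1) powr p - x powr p - trapezoid_gap p x"
proof -
  let ?h = "\<lambda>z. (z + 1) powr p - z powr p - trapezoid_gap p z"
  show ?thesis
  proof (rule DERIV_neg_imp_decreasing[OF \<open>x < y\<close>, where f = ?h])
    fix z assume "x \<le> z" "z \<le> y"
    then have z: "0 < z" using assms by simp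
    let ?d = "p * (z + 1) powr (p - 1) - p * z powr (p - 1) - ((z + 1) powr p - z powr p
      - (p * (z + 1) powr (p - 1) + p * z powr (p - 1)) / 2)"
    have "(?h has_real_derivative ?d) (at z)"
      by (intro DERIV_diff trapezoid_gap_deriv) (use z p in \<open>auto intro!: derivative_eq_intros\<close>)
    \<comment> \<open>The increment lies strictly between \<open>p * (z + 1) powr (p - 1)\<close>
      and \<open>p * z powr (p - 1)\<close>; the lower bound leaves at most half the difference of
      these two, which is negative.\<close>
    moreover have "?d < 0"
      using powr_diff_bounds[OF p z, of "z + 1"] by (simp add: field_simps)
    ultimately show "\<exists>d. (?h has_real_derivative d) (at z) \<and> d < 0"
      by blast
  qed
qed

section \<open>The coefficients a and b\<close>

lemma a_coeff_Suc:
  "a_coeff \<alpha> \<sigma> (Suc l) = (real l + \<sigma> + 1) powr (1 - \<alpha>) - (real l + \<sigma>) powr (1 - \<alpha>)"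
  by (simp add: a_coeff_def add_ac)

lemma b_coeff_Suc: "b_coeff \<alpha> \<sigma> (Suc l) = trapezoid_gap (1 - \<alpha>) (real l + \<sigma>)"
  by (simp add: b_coeff_def trapezoid_gap_def add_ac)

lemma a_coeff_pos:
  assumes "\<alpha> < 1" "0 < \<sigma>"
  shows "0 < a_coeff \<alpha> \<sigma> l"
proof (cases l)
  case 0
  with assms show ?thesis by (simp add: a_coeff_def)
next
  case (Suc k)
  with assms show ?thesis by (auto simp: a_coeff_Suc intro!: powr_less_mono2)
qed

text \<open>Since b is at most half of a, the difference is at least half of a, and the mean value
  theorem bounds a from below.\<close>

lemma a_minus_b_gt:
  assumes "0 < \<alpha>" "\<alpha> < 1" "0 < \<sigma>" "1 \<le> l"
  shows "(1 - \<alpha>) / 2 * (real l + \<sigma>) powr (- \<alpha>) < a_coeff \<alpha> \<sigma> l - b_coeff \<alpha> \<sigma> l"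
proof -
  obtain k where l: "l = Suc k" using \<open>1 \<le> l\<close> by (cases l) auto
  let ?x = "real k + \<sigma>"
  have "(1 - \<alpha>) * (?x + 1) powr (- \<alpha>) < (?x + 1) powr (1 - \<alpha>) - ?x powr (1 - \<alpha>)"
    using powr_diff_bounds(1)[of "1 - \<alpha>" ?x "?x + 1"] assms by simp
  moreover have "trapezoid_gap (1 - \<alpha>) ?x \<le> ((?x + 1) powr (1 - \<alpha>) - ?x powr (1 - \<alpha>)) / 2"
    using assms by (intro trapezoid_gap_le_half_increment) auto
  ultimately show ?thesis
    by (simp add: l a_coeff_Suc b_coeff_Suc add_ac)
qed

lemma b_coeff_nonneg:
  assumes "0 < \<alpha>" "\<alpha> < 1" "0 < \<sigma>" "1 \<le> l"
  shows "0 \<le> b_coeff \<alpha> \<sigma> l"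
  using assms by (cases l) (auto simp: b_coeff_Suc intro!: trapezoid_gap_nonneg)

lemma b_coeff_antimono:
  assumes "0 < \<alpha>" "\<alpha> < 1" "0 < \<sigma>" "1 \<le> l"
  shows "b_coeff \<alpha> \<sigma> (Suc l) \<le> b_coeff \<alpha> \<sigma> l"
  using assms by (cases l) (auto simp: b_coeff_Suc intro!: trapezoid_gap_antimono)

lemma a_minus_b_strict_antimono:
  assumes "0 < \<alpha>" "\<alpha> < 1" "0 < \<sigma>" "1 \<le> l"
  shows "a_coeff \<alpha> \<sigma> (Suc l) - b_coeff \<alpha> \<sigma> (Suc l) < a_coeff \<alpha> \<sigma> l - b_coeff \<alpha> \<sigma> l"
proof -
  obtain k where l: "l = Suc k" using \<open>1 \<le> l\<close> by (cases l) auto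
  show ?thesis
    unfolding l a_coeff_Suc b_coeff_Suc
    by (rule increment_minus_gap_strict_antimono) (use assms in auto)
qed

lemma first_coefficients_ineq:
  assumes "0 < \<alpha>" "\<alpha> < 1" and \<sigma>: "\<sigma> = 1 - \<alpha> / 2"
  shows "\<sigma> * a_coeff \<alpha> \<sigma> 1 < (2 * \<sigma> - 1) * (a_coeff \<alpha> \<sigma> 0 + b_coeff \<alpha> \<sigma> 1)"
proof -
  define U V where "U = (\<sigma> + 1) powr (1 - \<alpha>)" and "V = \<sigma> powr (1 - \<alpha>)"
  have bds: "1 / 2 < \<sigma>" "\<sigma> < 1" and p: "1 - \<alpha> = 2 * \<sigma> - 1"
    using assms by auto
  have "0 < U" using bds by (simp add: U_def)
  have pows: "(\<sigma> + 1) powr (2 - \<alpha>) = (\<sigma> + 1) * U" "\<sigma> powr (2 - \<alpha>) = \<sigma> * V"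
    using bds powr_mult_base[of "\<sigma> + 1" "1 - \<alpha>"] powr_mult_base[of \<sigma> "1 - \<alpha>"]
    by (simp_all add: U_def V_def)
  have a: "a_coeff \<alpha> \<sigma> 0 = V" "a_coeff \<alpha> \<sigma> 1 = U - V"
    by (simp_all add: a_coeff_def U_def V_def add.commute)
  have "b_coeff \<alpha> \<sigma> 1 = 1 / (2 * \<sigma>) * ((\<sigma> + 1) * U - \<sigma> * V) - 1 / 2 * (U + V)"
    using pows by (simp add: b_coeff_def U_def V_def add.commute \<sigma>)
  \<comment> \<open>Because 2 - \<alpha> = 2\<sigma>, all terms in \<open>V\<close> cancel.\<close>
  then have ab: "a_coeff \<alpha> \<sigma> 0 + b_coeff \<alpha> \<sigma> 1 = U / (2 * \<sigma>)"
    using bds a by (simp add: field_simps)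
  \<comment> \<open>Bernoulli's inequality for (1 + 1/\<sigma>) to the power 2\<sigma> - 1,
    multiplied by \<open>V\<close>.\<close>
  have "U < V * (1 + (2 * \<sigma> - 1) / \<sigma>)"
  proof -
    have "U - V < (1 - \<alpha>) * \<sigma> powr (1 - \<alpha> - 1)"
      using powr_diff_bounds(2)[of "1 - \<alpha>" \<sigma> "\<sigma> + 1"] assms bds by (simp add: U_def V_def)
    also have "\<sigma> powr (1 - \<alpha> - 1) = V / \<sigma>"
      using bds unfolding V_def by (subst powr_diff) simp
    finally show ?thesis by (simp only: p) (simp add: distrib_left mult.commute)
  qed
  then have Bernoulli: "\<sigma> * U < V * (3 * \<sigma> - 1)"
    using bds by (simp add: field_simps)
  \<comment> \<open>The goal amounts to \<open>U * (2 * \<sigma>\<^sup>2 - 2 * \<sigma> + 1) < 2 *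
    \<sigma>\<^sup>2 * V\<close>. Eliminating \<open>V\<close> by Bernoulli leaves a cubic
    inequality, whose two sides differ by exactly this product.\<close>
  have "(\<sigma> - 1) * (2 * \<sigma> - 1)\<^sup>2 < 0"
    using bds by (simp add: mult_neg_pos)
  then have "(3 * \<sigma> - 1) * (2 * \<sigma>\<^sup>2 - 2 * \<sigma> + 1) < 2 * \<sigma> ^ 3"
    by (simp add: algebra_simps power2_eq_square power3_eq_cube)
  then have "U * ((3 * \<sigma> - 1) * (2 * \<sigma>\<^sup>2 - 2 * \<sigma> + 1)) < U * (2 * \<sigma> ^ 3)"
    using \<open>0 < U\<close> by simp
  also have "U * (2 * \<sigma> ^ 3) = 2 * \<sigma>\<^sup>2 * (\<sigma> * U)"
    by (simp add: power2_eq_square power3_eq_cube)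
  also have "\<dots> < 2 * \<sigma>\<^sup>2 * (V * (3 * \<sigma> - 1))"
    using Bernoulli bds by simp
  finally have "(3 * \<sigma> - 1) * (U * (2 * \<sigma>\<^sup>2 - 2 * \<sigma> + 1)) < (3 * \<sigma> - 1) * (2 * \<sigma>\<^sup>2 * V)"
    by (simp add: mult_ac)
  then have "U * (2 * \<sigma>\<^sup>2 - 2 * \<sigma> + 1) < 2 * \<sigma>\<^sup>2 * V"
    using bds by simp
  then have "\<sigma> * (U - V) < (2 * \<sigma> - 1) * (U / (2 * \<sigma>))"
    using bds by (simp add: field_simps power2_eq_square)
  then show ?thesis by (simp only: a(2) ab)
qed

section \<open>Summation by parts and the three claims\<close>

text \<open>Abel summation of the first three terms; the fourth is nonnegative on its own.\<close>

lemma Abel_four_terms_pos: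
  fixes q0 q1 q2 q3 k0 k1 k2 k3 :: real
  assumes q: "q1 \<le> q0" "q2 \<le> q1" "q3 \<le> q2" "0 < q2" "0 \<le> q3"
    and k: "0 \<le> k0" "0 \<le> k0 + k1" "0 < k0 + k1 + k2" "0 \<le> k3"
  shows "0 < q0 * k0 + q1 * k1 + q2 * k2 + q3 * k3"
proof -
  have "0 \<le> (q0 - q1) * k0" "0 \<le> (q1 - q2) * (k0 + k1)" "0 < q2 * (k0 + k1 + k2)"
    "0 \<le> q3 * k3"
    using q k by auto
  then show ?thesis by (simp add: algebra_simps)
qed

theorem lemma3p4:
  fixes \<alpha> \<sigma> T \<tau> :: real and M j :: nat and lam lam' lam'' :: "real \<Rightarrow> real"
  assumes "0 < \<alpha>" and "\<alpha> < 1"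
    and "\<sigma> = 1 - \<alpha> / 2"
    and "0 < T" and "0 < M" and "\<tau> = T / real M"
    and "\<And>t. t \<in> {0..T} \<Longrightarrow> (lam has_real_derivative lam' t) (at t within {0..T})"
    and "\<And>t. t \<in> {0..T} \<Longrightarrow> (lam' has_real_derivative lam'' t) (at t within {0..T})"
    and "continuous_on {0..T} lam''"
    and "\<And>t. t \<in> {0..T} \<Longrightarrow> lam t > 0"
    and "\<And>t. t \<in> {0..T} \<Longrightarrow> lam' t \<le> 0"
    and "1 \<le> j" and "j \<le> M - 1"
  shows "c_coeff \<alpha> \<sigma> \<tau> lam j j
           > (1 - \<alpha>) / 2 * (lam ((real j + \<sigma>) * \<tau>) / (real j + \<sigma>) powr \<alpha>)
       \<and> (2 * \<sigma> - 1) * c_coeff \<alpha> \<sigma> \<tau> lam j 0 - \<sigma> * c_coeff \<alpha> \<sigma> \<tau> lam j 1 > 0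
       \<and> (\<forall>s<j. c_coeff \<alpha> \<sigma> \<tau> lam j s > c_coeff \<alpha> \<sigma> \<tau> lam j (Suc s))"
proof -
  define L where "L x = lam (x * \<tau>)" for x
  define a where "a = a_coeff \<alpha> \<sigma>"
  define b where "b = b_coeff \<alpha> \<sigma>"
  let ?c = "c_coeff \<alpha> \<sigma> \<tau> lam j"
  have \<sigma>: "1 / 2 < \<sigma>" "\<sigma> < 1" "0 < \<sigma>" using assms(1-3) by auto
  have \<tau>: "0 < \<tau>" using assms(4-6) by simp
  have in_range: "x * \<tau> \<in> {0..T}" if "0 \<le> x" "x \<le> real j + \<sigma>" for x
  proof -
    have "x \<le> real M" using that \<sigma> assms(5,13) by linarith
    then have "x * \<tau> \<le> real M * \<tau>" using \<tau> by (intro mult_right_mono) auto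
    also have "\<dots> = T" using assms(5,6) by simp
    finally show ?thesis using that \<tau> by simp
  qed
  have Lpos: "0 < L x" if "0 \<le> x" "x \<le> real j + \<sigma>" for x
    using assms(10) in_range[OF that] by (simp add: L_def)
  have Lmono: "L y \<le> L x" if "0 \<le> x" "x \<le> y" "y \<le> real j + \<sigma>" for x y
    unfolding L_def
  \<comment> \<open>The derivative is given only within \<open>{0..T}\<close>, so a two-sided one is
    available at interior points only; continuity covers the endpoints.\<close>
  proof (rule DERIV_nonpos_imp_decreasing_open[where f = lam])
    show "x * \<tau> \<le> y * \<tau>" using that \<tau> by simp
    have sub: "{x * \<tau>..y * \<tau>} \<subseteq> {0..T}"
      using in_range[of x] in_range[of y] that by auto
    have "continuous_on {0..T} lam"
      by (rule DERIV_continuous_on) (rule assms(7))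
    then show "continuous_on {x * \<tau>..y * \<tau>} lam"
      by (rule continuous_on_subset) (rule sub)
    fix z assume z: "x * \<tau> < z" "z < y * \<tau>"
    then have "0 < z" "z < T"
      using in_range[of x] in_range[of y] that by auto
    then show "\<exists>d. (lam has_real_derivative d) (at z) \<and> d \<le> 0"
      using assms(7)[of z] assms(11)[of z] by (auto simp: at_within_Icc_at)
  qed
  have apos: "0 < a l" for l
    unfolding a_def using assms \<sigma> by (intro a_coeff_pos) auto
  have bnn: "0 \<le> b l" if "1 \<le> l" for l
    unfolding b_def using assms \<sigma> that by (intro b_coeff_nonneg) auto
  have bmono: "b (Suc l) \<le> b l" if "1 \<le> l" for l
    unfolding b_def using assms \<sigma> that by (intro b_coeff_antimono) auto
  have ab: "(1 - \<alpha>) / 2 * (real l + \<sigma>) powr (- \<alpha>) < a l - b l" if "1 \<le> l" for l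
    unfolding a_def b_def using assms \<sigma> that by (intro a_minus_b_gt) auto
  have ab_pos: "0 < a l - b l" if "1 \<le> l" for l
    using ab[OF that] assms(2) by (smt (verit) divide_nonneg_nonneg powr_ge_zero mult_nonneg_nonneg)
  have abmono: "a (Suc l) - b (Suc l) < a l - b l" if "1 \<le> l" for l
    unfolding a_def b_def using assms \<sigma> that by (intro a_minus_b_strict_antimono) auto
  have c0: "?c 0 = L (\<sigma> - 1 / 2) * a 0 + L \<sigma> * b 1"
    by (simp add: c_coeff_def L_def a_def b_def)
  \<comment> \<open>Setting the b-term of index \<open>Suc s\<close> to zero at \<open>s = j\<close>
    merges the last two cases of the definition.\<close>
  have cs: "?c s = L (real s + \<sigma> - 1 / 2) * a s
      + L (real s + \<sigma>) * (if s < j then b (Suc s) else 0) - L (real s + \<sigma>) * b s"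
    if "1 \<le> s" "s \<le> j" for s
    using that by (auto simp: c_coeff_def L_def a_def b_def)

  have "(1 - \<alpha>) / 2 * (L (real j + \<sigma>) / (real j + \<sigma>) powr \<alpha>) < ?c j"
  proof -
    have "L (real j + \<sigma>) * ((1 - \<alpha>) / 2 * (real j + \<sigma>) powr (- \<alpha>)) < L (real j + \<sigma>) * (a j - b j)"
      using ab[of j] Lpos[of "real j + \<sigma>"] \<sigma> assms(12) by (intro mult_strict_left_mono) auto
    also have "\<dots> \<le> L (real j + \<sigma> - 1 / 2) * a j - L (real j + \<sigma>) * b j"
      using mult_right_mono[OF Lmono[of "real j + \<sigma> - 1 / 2" "real j + \<sigma>"], of "a j"] apos[of j] \<sigma>
      by (simp add: right_diff_distrib)
    also have "\<dots> = ?c j" using assms(12) by (simp add: cs)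
    finally show ?thesis by (simp add: powr_minus_divide mult_ac)
  qed
  moreover have second: "0 < (2 * \<sigma> - 1) * ?c 0 - \<sigma> * ?c 1"
  proof -
    define e where "e = (if 1 < j then b 2 else 0)"
    have e: "e \<le> b 1" using bmono[of 1] bnn[of 1] by (simp add: e_def numeral_2_eq_2)
    \<comment> \<open>Terms ordered by increasing argument of \<open>L\<close>; the two values at 1
      + \<sigma> in \<open>?c 1\<close> combine into the last one.\<close>
    have "0 < L (\<sigma> - 1 / 2) * ((2 * \<sigma> - 1) * a 0) + L \<sigma> * ((2 * \<sigma> - 1) * b 1)
      + L (1 + \<sigma> - 1 / 2) * (- (\<sigma> * a 1)) + L (1 + \<sigma>) * (\<sigma> * (b 1 - e))"
    proof (rule Abel_four_terms_pos)
      show "0 < (2 * \<sigma> - 1) * a 0 + (2 * \<sigma> - 1) * b 1 + - (\<sigma> * a 1)"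
        using first_coefficients_ineq[OF assms(1-3)] by (simp add: a_def b_def distrib_left)
      show "0 \<le> L (1 + \<sigma>)" using Lpos[of "1 + \<sigma>"] \<sigma> assms(12) by simp
    qed (use \<sigma> assms(12) apos[of 0] bnn[of 1] e in \<open>auto intro!: Lmono Lpos\<close>)
    also have "\<dots> = (2 * \<sigma> - 1) * ?c 0 - \<sigma> * ?c 1"
      using assms(12) by (simp add: c0 cs e_def numeral_2_eq_2 algebra_simps)
    finally show ?thesis .
  qed
  moreover have "?c (Suc s) < ?c s" if "s < j" for s
  proof (cases "s = 0")
    case True
    \<comment> \<open>For \<open>s = 0\<close> the second claim suffices: as \<open>?c 0\<close> is
      positive and 2\<sigma> - 1 < \<sigma>, it forces \<open>?c 1 < ?c 0\<close>.\<close>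
    have "0 < ?c 0"
      unfolding c0 using apos[of 0] bnn[of 1] Lpos[of "\<sigma> - 1 / 2"] Lpos[of \<sigma>] \<sigma>
      by (intro add_pos_nonneg mult_pos_pos mult_nonneg_nonneg) auto
    then have "(2 * \<sigma> - 1) * ?c 0 < \<sigma> * ?c 0"
      using \<sigma> by (intro mult_strict_right_mono) auto
    with second have "\<sigma> * ?c 1 < \<sigma> * ?c 0" by linarith
    then show ?thesis using \<sigma> True by simp
  next
    case False
    then have s: "1 \<le> s" by simp
    define e where "e = (if Suc s < j then b (Suc (Suc s)) else 0)"
    have e: "e \<le> b (Suc s)" using bmono[of "Suc s"] bnn[of "Suc s"] by (simp add: e_def)
    \<comment> \<open>The third partial sum of the multipliers is the decrease of a - b from
      \<open>s\<close> to \<open>Suc s\<close>.\<close>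
    have "0 < L (real s + \<sigma> - 1 / 2) * a s + L (real s + \<sigma>) * (b (Suc s) - b s)
      + L (real (Suc s) + \<sigma> - 1 / 2) * (- a (Suc s)) + L (real (Suc s) + \<sigma>) * (b (Suc s) - e)"
    proof (rule Abel_four_terms_pos)
      show "0 \<le> a s + (b (Suc s) - b s)" using ab_pos[OF s] bnn[of "Suc s"] by simp
      show "0 < a s + (b (Suc s) - b s) + - a (Suc s)" using abmono[OF s] by simp
      show "0 \<le> L (real (Suc s) + \<sigma>)" using Lpos[of "real (Suc s) + \<sigma>"] \<sigma> that by simp
    qed (use \<sigma> that apos[of s] e in \<open>auto intro!: Lmono Lpos\<close>)
    also have "\<dots> = ?c s - ?c (Suc s)"
      using s that by (simp add: cs e_def algebra_simps)
    finally show ?thesis by simp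
  qed
  ultimately show ?thesis by (simp add: L_def)
qed

end
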